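(* Let $p$ be a prime, let $0\le n<m\le p$, $0\le i\le p-1$ and $r\ge s\ge m(p+1)-1$. If $r\equiv s\bmod p(p-1)$, then, as $\Gamma$-modules, $$\frac{V_r^{(n)}}{V_r^{(m)}}\cong\frac{V_s^{(n)}}{V_s^{(m)}}\qquad\text{and}\qquad \frac{X_{r-i,\,r}^{(n)}}{X_{r-i,\,r}^{(m)}}\cong\frac{X_{s-i,\,s}^{(n)}}{X_{s-i,\,s}^{(m)}}.$$ In particular, for all $0\le i\le p-1$, the quotient $Q(i)$ of $V_r$ is periodic in $r$ with period $p(p-1)$ for $r\ge i(p+1)+p$; that is, if $r\ge s\ge i(p+1)+p$ and $r\equiv s\bmod p(p-1)$, then $V_r/(X_{r-i,\,r}+V_r^{(i+1)})\cong V_s/(X_{s-i,\,s}+V_s^{(i+1)})$ as $\Gamma$-modules.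
   Context: Let $\Gamma=\mathrm{GL}_2(\mathbb{F}_p)$. $V_r$ is the $\mathbb{F}_p$-space of homogeneous polynomials $F(X,Y)$ of degree $r$ over $\mathbb{F}_p$, with action $\begin{pmatrix} a&b\\c&d\end{pmatrix}\cdot F(X,Y)=F(aX+cY,\,bX+dY)$. $X_{r-i,\,r}\subseteq V_r$ is the $\mathbb{F}_p[\Gamma]$-submodule generated by $X^{r-i}Y^{i}$. Let $\theta=X^pY-XY^p$ and, for $m\ge0$, $V_r^{(m)}=\{F\in V_r:\theta^m\mid F\}$, a $\Gamma$-submodule of $V_r$; $X_{r-i,\,r}^{(m)}=X_{r-i,\,r}\cap V_r^{(m)}$. $Q(i)=V_r/(X_{r-i,\,r}+V_r^{(i+1)})$. *)

theory Defs
  imports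
    "HOL-Analysis.Determinants"
    "HOL-Library.Set_Algebras"
    "HOL-Number_Theory.Cong"
    "Berlekamp_Zassenhaus.Finite_Field"
begin

text \<open>
  Throughout, \<open>'p mod_ring\<close> with \<open>'p :: prime_card\<close> is the field with \<open>p = CARD('p)\<close> elements.
  Polynomials in \<open>X, Y\<close> are elements of \<open>'p mod_ring poly poly\<close>: the inner variable is \<open>X\<close>, the
  outer one is \<open>Y\<close>, so the coefficient of \<open>X^i Y^j\<close> in \<open>F\<close> is \<open>coeff (coeff F j) i\<close>.
\<close>

type_synonym 'p bipoly = "'p mod_ring poly poly"
type_synonym 'p mat2 = "'p mod_ring ^ 2 ^ 2"

definition PX :: "'p::prime_card bipoly" where "PX = [:[:0, 1:]:]"
definition PY :: "'p::prime_card bipoly" where "PY = [:0, 1:]"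

definition const :: "'p::prime_card mod_ring \<Rightarrow> 'p bipoly" where "const c = [:[:c:]:]"

text \<open>The substitution \<open>F(P, Q)\<close>.\<close>

definition subst2 :: "'p::prime_card bipoly \<Rightarrow> 'p bipoly \<Rightarrow> 'p bipoly \<Rightarrow> 'p bipoly" where
  "subst2 F P Q = poly (map_poly (\<lambda>f. poly (map_poly const f) P) F) Q"

definition GL2 :: "'p::prime_card mat2 set" where
  "GL2 = {g. invertible g}"

text \<open>\<open>(a, b; c, d) \<cdot> F(X, Y) = F(aX + cY, bX + dY)\<close>, where \<open>g $ i $ j\<close> is the entry in row \<open>i\<close> and
  column \<open>j\<close>.\<close>

definition act :: "'p::prime_card mat2 \<Rightarrow> 'p bipoly \<Rightarrow> 'p bipoly" where
  "act g F = subst2 F (const (g $ 1 $ 1) * PX + const (g $ 2 $ 1) * PY)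
                      (const (g $ 1 $ 2) * PX + const (g $ 2 $ 2) * PY)"

definition Vhom :: "nat \<Rightarrow> 'p::prime_card bipoly set" where
  "Vhom r = {F. \<forall>i j. coeff (coeff F j) i \<noteq> 0 \<longrightarrow> i + j = r}"

definition theta :: "'p::prime_card bipoly" where
  "theta = PX ^ CARD('p) * PY - PX * PY ^ CARD('p)"

definition Vdiv :: "nat \<Rightarrow> nat \<Rightarrow> 'p::prime_card bipoly set" where
  "Vdiv r m = {F \<in> Vhom r. theta ^ m dvd F}"

definition is_submodule :: "'p::prime_card bipoly set \<Rightarrow> bool" where
  "is_submodule U \<longleftrightarrow> 0 \<in> U \<and> (\<forall>F\<in>U. \<forall>G\<in>U. F + G \<in> U) \<and> (\<forall>c. \<forall>F\<in>U. const c * F \<in> U) \<and>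
     (\<forall>g\<in>GL2. \<forall>F\<in>U. act g F \<in> U)"

text \<open>\<open>Xsub r i\<close> is \<open>X_{r-i,r}\<close>, the submodule of \<open>Vhom r\<close> generated by \<open>X^(r-i) Y^i\<close>.  It is only
  meaningful for \<open>i \<le> r\<close>.\<close>

definition Xsub :: "nat \<Rightarrow> nat \<Rightarrow> 'p::prime_card bipoly set" where
  "Xsub r i = (\<lambda>U. is_submodule U \<and> U \<subseteq> Vhom r) hull {PX ^ (r - i) * PY ^ i}"

definition Xdiv :: "nat \<Rightarrow> nat \<Rightarrow> nat \<Rightarrow> 'p::prime_card bipoly set" where
  "Xdiv r i m = Xsub r i \<inter> Vdiv r m"

record ('p, 'v) gmodule =
  gcarrier :: "'v set"
  gadd :: "'v \<Rightarrow> 'v \<Rightarrow> 'v"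
  gscale :: "'p mod_ring \<Rightarrow> 'v \<Rightarrow> 'v"
  gact :: "'p mat2 \<Rightarrow> 'v \<Rightarrow> 'v"

text \<open>The quotient \<open>U / W\<close> for submodules \<open>W \<subseteq> U\<close>, as the set of cosets \<open>F + W\<close>.  Scalar
  multiplication adds \<open>W\<close> so that \<open>0 \<cdot> (F + W)\<close> is the coset \<open>W\<close> and not \<open>{0}\<close>; the elements of
  \<open>GL2\<close> act bijectively, so for them the image of a coset is a coset.\<close>

definition quot :: "'p::prime_card bipoly set \<Rightarrow> 'p bipoly set \<Rightarrow> ('p, 'p bipoly set) gmodule" where
  "quot U W =
     \<lparr> gcarrier = (\<lambda>F. F +o W) ` U,
       gadd = (\<lambda>C D. C + D),
       gscale = (\<lambda>c C. (\<lambda>F. const c * F) ` C + W),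
       gact = (\<lambda>g C. act g ` C) \<rparr>"

definition gmodule_iso ::
    "('p::prime_card, 'v) gmodule \<Rightarrow> ('p, 'w) gmodule \<Rightarrow> ('v \<Rightarrow> 'w) \<Rightarrow> bool" where
  "gmodule_iso M N \<phi> \<longleftrightarrow>
     bij_betw \<phi> (gcarrier M) (gcarrier N) \<and>
     (\<forall>x\<in>gcarrier M. \<forall>y\<in>gcarrier M. \<phi> (gadd M x y) = gadd N (\<phi> x) (\<phi> y)) \<and>
     (\<forall>c. \<forall>x\<in>gcarrier M. \<phi> (gscale M c x) = gscale N c (\<phi> x)) \<and>
     (\<forall>g\<in>GL2. \<forall>x\<in>gcarrier M. \<phi> (gact M g x) = gact N g (\<phi> x))"

definition gmodule_isomorphic ::
    "('p::prime_card, 'v) gmodule \<Rightarrow> ('p, 'w) gmodule \<Rightarrow> bool" (infix \<open>\<cong>\<^sub>\<Gamma>\<close> 50) where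
  "M \<cong>\<^sub>\<Gamma> N \<longleftrightarrow> (\<exists>\<phi>. gmodule_iso M N \<phi>)"

definition Qmod :: "nat \<Rightarrow> nat \<Rightarrow> ('p::prime_card, 'p bipoly set) gmodule" where
  "Qmod r i = quot (Vhom r) (Xsub r i + Vdiv r (i + 1))"

end

theory Submission
  imports Defs
begin

text \<open>
  Write \<open>r = s + k\<close> with \<open>p (p - 1)\<close> dividing \<open>k\<close>.  The polynomial \<open>theta\<close> is, up to sign, the product
  of the \<open>p + 1\<close> rational lines \<open>l\<close>, which are pairwise coprime, so that a class modulo \<open>theta ^ m\<close> is
  determined by its classes modulo the powers \<open>l ^ m\<close> (\<open>theta_power_dvd_iff\<close>).  For \<open>m \<le> p\<close> the class of
  \<open>u ^ k\<close> modulo \<open>l ^ m\<close> is the same for all linear forms \<open>u\<close> that are independent of \<open>l\<close>, by the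
  Frobenius map and Fermat's little theorem (\<open>linear_form_power_cong\<close>).  Hence multiplication by
  \<open>u ^ k\<close>, with \<open>u\<close> chosen separately at each line, is a canonical and therefore equivariant way to
  pass from degree \<open>s\<close> to degree \<open>r\<close>.

  It is expressed as a relation \<open>loc_rel\<close> between forms of the two degrees.  This
  relation is compatible with addition, scalars and the group, and it matches divisibility by
  \<open>theta ^ n\<close> for \<open>n \<le> m\<close>, because \<open>u ^ k\<close> is invertible modulo \<open>l ^ n\<close>.  If \<open>Z\<close> is \<open>X\<close> or \<open>Y\<close> and
  \<open>Z ^ m\<close> divides \<open>F\<close>, then \<open>F\<close> is related to \<open>Z ^ k * F\<close> (\<open>loc_rel_mult_power\<close>).  This covers all
  monomials of degree \<open>s\<close>, and, up to multiples of \<open>theta ^ m\<close>, all those of degree \<open>r\<close>; so the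
  relation is total and onto (\<open>loc_rel_total\<close>, \<open>loc_rel_onto\<close>).  It also relates the generator
  \<open>X ^ (s - i) * Y ^ i\<close> to \<open>X ^ (r - i) * Y ^ i\<close>, so it is total and onto between the submodules that
  they generate.  A submodule of a product with these properties induces isomorphisms of all the
  quotients concerned (\<open>quot_isomorphic\<close>); for \<open>Qmod\<close> one takes \<open>m = i + 1\<close>.
\<close>

section \<open>Substitution as a ring homomorphism\<close>

lemma const_hom_simps:
  "const 0 = (0::'p::prime_card bipoly)" "const 1 = (1::'p bipoly)"
  "const (a + b) = const a + (const b::'p bipoly)" "const (a * b) = const a * (const b::'p bipoly)"
  "const (- a) = - (const a::'p bipoly)"
  by (simp_all add: const_def one_pCons)

interpretation const: comm_ring_hom "const :: 'p::prime_card mod_ring \<Rightarrow> 'p bipoly"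
  by unfold_locales (simp_all add: const_hom_simps)

interpretation map_const: map_poly_comm_ring_hom "const :: 'p::prime_card mod_ring \<Rightarrow> 'p bipoly" ..

lemma eval_const_hom: "comm_ring_hom (\<lambda>f. poly (map_poly const f) (P::'p::prime_card bipoly))"
  by unfold_locales (simp_all add: const_hom_simps hom_distribs)

lemma subst2_hom: "comm_ring_hom (\<lambda>F. subst2 F (P::'p::prime_card bipoly) Q)"
proof -
  interpret comm_ring_hom "\<lambda>f. poly (map_poly const f) P" by (rule eval_const_hom)
  interpret map_poly_comm_ring_hom "\<lambda>f. poly (map_poly const f) P" ..
  show ?thesis unfolding subst2_def by unfold_locales (simp_all add: hom_distribs)
qed

lemma subst2_generators:
  fixes P Q :: "'p::prime_card bipoly"
  shows "subst2 PX P Q = P" "subst2 PY P Q = Q" "subst2 (const c) P Q = const c"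
proof -
  interpret comm_ring_hom "\<lambda>f. poly (map_poly const f) P" by (rule eval_const_hom)
  interpret map_poly_comm_ring_hom "\<lambda>f. poly (map_poly const f) P" ..
  show "subst2 PX P Q = P" "subst2 PY P Q = Q" "subst2 (const c) P Q = const c"
    by (simp_all add: subst2_def PX_def PY_def const_def[of c] hom_distribs const_hom_simps)
qed

interpretation act: comm_ring_hom "act g :: 'p::prime_card bipoly \<Rightarrow> _" for g
  unfolding act_def by (rule subst2_hom)

lemma act_PX: "act g PX = const (g $ 1 $ 1) * PX + const (g $ 2 $ 1) * PY"
  and act_PY: "act g PY = const (g $ 1 $ 2) * PX + const (g $ 2 $ 2) * PY"
  and act_const: "act g (const c) = const c"
  by (simp_all add: act_def subst2_generators)

text \<open>
  \<open>X\<close>, \<open>Y\<close> and the constants generate the polynomial ring; this turns the composition law for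
  \<open>act\<close> into an identity between linear forms.
\<close>

lemma bipoly_hom_eqI:
  fixes \<phi> \<psi> :: "'p::prime_card bipoly \<Rightarrow> 'p bipoly"
  assumes "comm_ring_hom \<phi>" "comm_ring_hom \<psi>"
    and c: "\<And>c. \<phi> (const c) = \<psi> (const c)" and X: "\<phi> PX = \<psi> PX" and Y: "\<phi> PY = \<psi> PY"
  shows "\<phi> F = \<psi> F"
proof -
  interpret f: comm_ring_hom \<phi> by fact
  interpret g: comm_ring_hom \<psi> by fact
  have inner: "\<phi> [:f:] = \<psi> [:f:]" for f
  proof (induction f)
    case (pCons a f)
    have "[:pCons a f:] = const a + PX * [:f:]" by (simp add: const_def PX_def)
    then show ?case by (simp only: f.hom_add g.hom_add f.hom_mult g.hom_mult pCons.IH c X)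
  qed simp
  show ?thesis
  proof (induction F)
    case (pCons f F)
    have "pCons f F = [:f:] + PY * F" by (simp add: PY_def)
    then show ?case by (simp only: f.hom_add g.hom_add f.hom_mult g.hom_mult pCons.IH inner Y)
  qed simp
qed

lemma act_act: "act g (act h F) = act (g ** h) F"
proof (rule bipoly_hom_eqI[of "\<lambda>F. act g (act h F)"])
  show "comm_ring_hom (\<lambda>F. act g (act h F))"
    by unfold_locales (simp_all add: act.hom_add act.hom_mult)
  show "comm_ring_hom (act (g ** h))" ..
qed (simp_all add: act_const act_PX act_PY act.hom_add act.hom_mult matrix_matrix_mult_def
       sum_2 const_hom_simps algebra_simps)

lemma act_mat_1: "act (mat 1) F = F"
proof (rule bipoly_hom_eqI[of "act (mat 1)" "\<lambda>F. F"])
  show "comm_ring_hom (act (mat 1))" ..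
  show "comm_ring_hom (\<lambda>F. F)" by unfold_locales simp_all
qed (simp_all add: act_const act_PX act_PY mat_def const_hom_simps)

section \<open>Homogeneous polynomials\<close>

lemma const_eq_smult: "const c * F = Polynomial.smult [:c:] F"
  by (simp add: const_def)

lemma monomial_eq: "PX ^ a * PY ^ b = (Polynomial.monom (Polynomial.monom 1 a) b :: 'p::prime_card bipoly)"
proof -
  have "(PX :: 'p bipoly) ^ a = [:Polynomial.monom 1 a:]"
    by (induction a) (simp_all add: PX_def one_pCons monom_Suc)
  moreover have "(PY :: 'p bipoly) ^ b = Polynomial.monom 1 b"
    by (simp add: PY_def x_as_monom monom_power)
  ultimately show ?thesis by (simp add: smult_monom)
qed

lemma Vhom_coeff_eq_0: "F \<in> Vhom r \<Longrightarrow> i + j \<noteq> r \<Longrightarrow> coeff (coeff F j) i = 0"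
  unfolding Vhom_def by blast

lemma Vhom_0: "0 \<in> Vhom r"
  by (simp add: Vhom_def)

lemma Vhom_add: "F \<in> Vhom r \<Longrightarrow> G \<in> Vhom r \<Longrightarrow> F + G \<in> Vhom r"
  by (auto simp: Vhom_def) (metis add.left_neutral)

lemma Vhom_mult:
  assumes "F \<in> Vhom a" "G \<in> Vhom b"
  shows "F * G \<in> Vhom (a + b)"
  unfolding Vhom_def
proof (intro CollectI allI impI)
  fix i j assume "coeff (coeff (F * G) j) i \<noteq> 0"
  then have "(\<Sum>l\<le>j. \<Sum>k\<le>i. coeff (coeff F l) k * coeff (coeff G (j - l)) (i - k)) \<noteq> 0"
    by (simp add: coeff_mult coeff_sum)
  then obtain l where l: "l \<le> j" "(\<Sum>k\<le>i. coeff (coeff F l) k * coeff (coeff G (j - l)) (i - k)) \<noteq> 0"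
    by (auto elim: sum.not_neutral_contains_not_neutral)
  then obtain k where k: "k \<le> i" "coeff (coeff F l) k * coeff (coeff G (j - l)) (i - k) \<noteq> 0"
    by (auto elim: sum.not_neutral_contains_not_neutral)
  then have "k + l = a" "(i - k) + (j - l) = b"
    using assms by (auto simp: Vhom_def)
  then show "i + j = a + b" using l k by linarith
qed

lemma Vhom_power: "F \<in> Vhom a \<Longrightarrow> F ^ n \<in> Vhom (n * a)"
  by (induction n) (auto simp: Vhom_mult, simp add: Vhom_def one_pCons coeff_pCons split: nat.splits)

lemma Vhom_const: "const c \<in> Vhom 0"
  by (auto simp: Vhom_def const_def coeff_pCons split: nat.splits)

lemma Vhom_const_mult: "F \<in> Vhom r \<Longrightarrow> const c * F \<in> Vhom r"
  using Vhom_mult[OF Vhom_const] by simp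

lemma Vhom_diff: "F \<in> Vhom r \<Longrightarrow> G \<in> Vhom r \<Longrightarrow> F - G \<in> Vhom r"
  using Vhom_add[of F r "const (-1) * G"] Vhom_const_mult[of G r "-1"] by (simp add: const_hom_simps)

lemma Vhom_PX: "PX \<in> Vhom 1" and Vhom_PY: "PY \<in> Vhom 1"
  by (auto simp: Vhom_def PX_def PY_def coeff_pCons split: nat.splits if_splits)

lemma Vhom_monomial: "PX ^ a * PY ^ b \<in> Vhom (a + b)"
  using Vhom_mult[OF Vhom_power[OF Vhom_PX, of a] Vhom_power[OF Vhom_PY, of b]] by simp

text \<open>
  Gaussian elimination on the degree in \<open>Y\<close>: a homogeneous polynomial of degree \<open>r\<close> has the leading
  coefficient \<open>c X^(r - j)\<close>, so subtracting a multiple of \<open>H\<close> lowers its degree in \<open>Y\<close>.  The freedom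
  in the choice of \<open>H\<close> matters below, where some leading terms come from multiples of a power of
  \<open>theta\<close> instead of from monomials.
\<close>

lemma Vhom_leading_induct:
  fixes S :: "'p::prime_card bipoly set"
  assumes zero: "0 \<in> S" and add: "\<And>F G. F \<in> S \<Longrightarrow> G \<in> S \<Longrightarrow> F + G \<in> S"
    and scale: "\<And>c F. F \<in> S \<Longrightarrow> const c * F \<in> S"
    and lead: "\<And>j. j \<le> r \<Longrightarrow> \<exists>H\<in>S \<inter> Vhom r.
                 coeff H j = Polynomial.monom 1 (r - j) \<and> (\<forall>l>j. coeff H l = 0)"
  shows "Vhom r \<subseteq> S"
proof -
  have "G \<in> S" if "G \<in> Vhom r" "\<forall>l\<ge>n. coeff G l = 0" for n G
    using that
  proof (induction n arbitrary: G)
    case 0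
    then have "G = 0" by (intro poly_eqI) simp
    then show ?case using zero by simp
  next
    case (Suc n)
    show ?case
    proof (cases "n \<le> r")
      case False
      then have "coeff (coeff G n) i = 0" for i
        using False by (intro Vhom_coeff_eq_0[OF Suc.prems(1)]) simp
      then have "coeff G n = 0" by (intro poly_eqI) simp
      then have "\<forall>l\<ge>n. coeff G l = 0"
        using Suc.prems(2) by (metis le_antisym not_less_eq_eq)
      then show ?thesis using Suc by blast
    next
      case True
      obtain H where H: "H \<in> S" "H \<in> Vhom r" "coeff H n = Polynomial.monom 1 (r - n)"
        "\<forall>l>n. coeff H l = 0"
        using lead[OF True] by blast
      define c where "c = coeff (coeff G n) (r - n)"
      have "coeff G n = Polynomial.monom c (r - n)"
      proof (rule poly_eqI)
        fix i
        show "coeff (coeff G n) i = coeff (Polynomial.monom c (r - n)) i"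
          using True Vhom_coeff_eq_0[OF Suc.prems(1), of i n] by (cases "i = r - n") (auto simp: c_def)
      qed
      then have "coeff (G - const c * H) l = 0" if "n \<le> l" for l
        using that H(3,4) Suc.prems(2) by (cases "l = n") (simp_all add: const_eq_smult smult_monom)
      then have "G - const c * H \<in> S"
        using Suc.IH Vhom_diff[OF Suc.prems(1) Vhom_const_mult[OF H(2)]] by blast
      from add[OF this scale[OF H(1), of c]] show ?thesis by simp
    qed
  qed
  moreover have "\<forall>l\<ge>Suc (degree G). coeff G l = 0" for G :: "'p bipoly"
    by (simp add: coeff_eq_0)
  ultimately show ?thesis by blast
qed

lemma Vhom_act:
  assumes "F \<in> Vhom r"
  shows "act g F \<in> Vhom r"
proof -
  have lin: "const a * PX + const c * PY \<in> Vhom 1" for a c :: "'a mod_ring"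
    by (intro Vhom_add Vhom_const_mult Vhom_PX Vhom_PY)
  have "Vhom r \<subseteq> {F. act g F \<in> Vhom r}"
  proof (rule Vhom_leading_induct)
    fix j assume "j \<le> r"
    then have "act g (PX ^ (r - j) * PY ^ j) \<in> Vhom r"
      using Vhom_mult[OF Vhom_power[OF lin[of "g $ 1 $ 1" "g $ 2 $ 1"], of "r - j"]
        Vhom_power[OF lin[of "g $ 1 $ 2" "g $ 2 $ 2"], of j]]
      by (simp add: act.hom_mult act.hom_power act_PX act_PY)
    moreover have "PX ^ (r - j) * PY ^ j \<in> Vhom r"
      using Vhom_monomial[of "r - j" j] \<open>j \<le> r\<close> by simp
    ultimately show "\<exists>H\<in>{F. act g F \<in> Vhom r} \<inter> Vhom r.
        coeff H j = Polynomial.monom 1 (r - j) \<and> (\<forall>l>j. coeff H l = 0)"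
      by (intro bexI[of _ "PX ^ (r - j) * PY ^ j"]) (auto simp: monomial_eq)
  qed (auto simp: Vhom_0 Vhom_add Vhom_const_mult act.hom_add act.hom_mult act_const)
  then show ?thesis using assms by blast
qed

section \<open>Powers of linear forms\<close>

lemma frobenius_linear_form:
  "(const a * PX + const c * PY) ^ CARD('p) =
     const a * PX ^ CARD('p) + const c * (PY::'p::prime_card bipoly) ^ CARD('p)"
proof -
  have "x ^ CARD('p) = x" for x :: "'p mod_ring"
    using finite_field_power_card_eq_same[of x] by simp
  then show ?thesis
    by (subst freshmans_dream)
       (simp_all add: prime_card power_mult_distrib const.hom_power[symmetric])
qed

text \<open>
  The congruence behind the period \<open>p (p - 1)\<close>.  If \<open>a = 0\<close>, the factor \<open>L ^ m\<close> is itself a multiple of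
  \<open>Y ^ m\<close>.  Otherwise \<open>L ^ p = a X ^ p + c Y ^ p\<close> is congruent to \<open>a X ^ p\<close> modulo \<open>Y ^ p\<close>, and raising
  this to a multiple of \<open>p - 1\<close> removes the scalar \<open>a\<close>.
\<close>

lemma linear_form_power_cong:
  fixes a c :: "'p::prime_card mod_ring"
  assumes k: "CARD('p) * (CARD('p) - 1) dvd k" and m: "m \<le> CARD('p)"
  defines "L \<equiv> const a * PX + const c * PY"
  shows "PY ^ m dvd (L ^ k - PX ^ k) * L ^ m"
proof (cases "a = 0")
  case True
  then have "L ^ m = const c ^ m * PY ^ m" by (simp add: L_def const_hom_simps power_mult_distrib)
  then show ?thesis by simp
next
  case False
  let ?p = "CARD('p)"
  obtain N where N: "k = ?p * ((?p - 1) * N)" using k by (metis dvdE mult.assoc)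
  have "a * a ^ (?p - 1) = a * 1"
    using finite_field_power_card_eq_same[of a] by (simp flip: power_Suc)
  then have "a ^ (?p - 1) = 1" using mult_left_cancel[OF False] by blast
  then have aN: "const a ^ ((?p - 1) * N) = 1"
    by (simp add: power_mult const_hom_simps flip: const.hom_power)
  have "PY ^ ?p dvd L ^ ?p - const a * PX ^ ?p"
    unfolding L_def frobenius_linear_form by simp
  also have "\<dots> dvd (L ^ ?p) ^ ((?p - 1) * N) - (const a * PX ^ ?p) ^ ((?p - 1) * N)"
    unfolding power_diff_sumr2[of "L ^ ?p" _ "const a * PX ^ ?p"] by (rule dvd_triv_left)
  also have "\<dots> = L ^ k - PX ^ k"
    using aN by (simp add: power_mult_distrib N power_mult)
  finally have "PY ^ m dvd L ^ k - PX ^ k"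
    using m by (metis dvd_trans le_imp_power_dvd)
  then show ?thesis by simp
qed

section \<open>Divisibility by powers of theta\<close>

lemma prod_dvd_of_pairwise_coprime:
  fixes f :: "'i \<Rightarrow> 'a::semiring_gcd"
  assumes "finite A" "\<And>i. i \<in> A \<Longrightarrow> f i dvd x"
    and "\<And>i j. i \<in> A \<Longrightarrow> j \<in> A \<Longrightarrow> i \<noteq> j \<Longrightarrow> coprime (f i) (f j)"
  shows "prod f A dvd x"
  using assms
proof (induction A rule: finite_induct)
  case (insert i A)
  then have "coprime (f i) (prod f A)" by (intro prod_coprime_right) auto
  then show ?case using insert by (simp add: divides_mult)
qed simp

text \<open>
  Up to the factor \<open>- X\<close>, \<open>theta\<close> is \<open>Y ^ p - X ^ (p - 1) * Y\<close>, a monic polynomial of degree \<open>p\<close> in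
  \<open>Y\<close> that has the \<open>p\<close> roots \<open>c X\<close> by the little theorem of Fermat.
\<close>

lemma theta_eq_prod:
  "theta = - (PX * (\<Prod>c\<in>UNIV. PY - const c * (PX::'p::prime_card bipoly)))"
proof -
  let ?p = "CARD('p)"
  define q :: "'p bipoly" where "q = (\<Prod>c\<in>UNIV. PY - const c * PX)"
  have lin: "PY - const c * PX = [:[:0, - c:], 1:]" for c :: "'p mod_ring"
    by (simp add: PX_def PY_def const_def)
  have p1: "?p > 1" using prime_card prime_gt_1_nat by blast
  have deg: "degree q = ?p"
    unfolding q_def lin by (subst degree_prod_eq_sum_degree) auto
  have "lead_coeff q = 1"
    unfolding q_def lin by (subst lead_coeff_prod) simp
  then have lc: "coeff q ?p = 1" by (simp add: deg)
  define t :: "'p bipoly" where "t = PY ^ ?p - PX ^ (?p - 1) * PY"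
  have t: "t = Polynomial.monom 1 ?p - Polynomial.monom (Polynomial.monom 1 (?p - 1)) 1"
    using monomial_eq[where 'p = 'p, of 0 ?p] monomial_eq[where 'p = 'p, of "?p - 1" 1] by (simp add: t_def)
  have "t = q"
  proof (rule poly_eqI_degree_lead_coeff)
    show "coeff t ?p = coeff q ?p" using p1 by (simp add: t lc)
    show "degree t \<le> ?p" unfolding t
      by (rule degree_diff_le) (use p1 in \<open>auto intro: order.trans[OF degree_monom_le]\<close>)
    show "degree q \<le> ?p" by (simp add: deg)
    show "?p \<le> card (range (\<lambda>c::'p mod_ring. [:0, c:]))"
      by (subst card_image) (auto simp: inj_on_def)
  next
    fix z :: "'p mod_ring poly" assume "z \<in> range (\<lambda>c. [:0, c:])"
    then obtain c where z: "z = Polynomial.monom c 1" by (auto simp: monom_Suc monom_0)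
    have "poly q z = 0"
      unfolding q_def lin poly_prod by (rule prod_zero) (auto simp: z monom_Suc monom_0 intro: exI[of _ c])
    moreover have "poly t z = 0"
      using p1 finite_field_power_card_eq_same[of c]
      by (simp add: t poly_monom z monom_power mult_monom)
    ultimately show "poly t z = poly q z" by simp
  qed
  moreover have "theta = - (PX * t)"
    using p1 by (simp add: theta_def t_def algebra_simps flip: power_Suc power_Suc2)
  ultimately show ?thesis by (simp add: q_def)
qed

lemma coprime_PX_PY: "coprime PX (PY :: 'p::prime_card bipoly)"
proof (rule coprimeI)
  fix d :: "'p bipoly" assume d: "d dvd PX" "d dvd PY"
  have "degree d \<le> degree (PX :: 'p bipoly)" by (rule dvd_imp_degree_le[OF d(1)]) (simp add: PX_def)
  then obtain f where f: "d = [:f:]" by (auto simp: PX_def elim: degree_eq_zeroE)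
  then have "f dvd 1" using d(2) by (auto simp: PY_def const_poly_dvd_iff coeff_pCons split: nat.splits dest: spec[of _ 1])
  then show "is_unit d" by (simp add: f is_unit_const_poly_iff)
qed

lemma coprime_PX_line: "coprime PX (PY - const c * (PX :: 'p::prime_card bipoly))"
proof (rule coprimeI)
  fix d assume "d dvd PX" "d dvd PY - const c * PX"
  then have "d dvd PX" "d dvd PY"
    by (simp_all add: dvd_diff_left_iff)
  then show "is_unit d" using coprime_PX_PY coprime_common_divisor by blast
qed

lemma coprime_lines:
  assumes "c \<noteq> d"
  shows "coprime (PY - const c * PX) (PY - const d * (PX :: 'p::prime_card bipoly))"
proof (rule coprimeI)
  fix e assume e: "e dvd PY - const c * PX" "e dvd PY - const d * PX"
  have "e dvd const (inverse (d - c)) * ((PY - const c * PX) - (PY - const d * PX))"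
    by (rule dvd_mult) (rule dvd_diff[OF e])
  also have "\<dots> = const (inverse (d - c) * (d - c)) * PX"
    by (simp only: const.hom_mult const.hom_minus algebra_simps)
  also have "\<dots> = PX" using assms by (simp add: const_hom_simps)
  finally show "is_unit e" using e coprime_PX_line coprime_common_divisor by blast
qed

lemma theta_power_dvdI:
  fixes F :: "'p::prime_card bipoly"
  assumes "\<And>g. PY ^ m dvd act g F"
  shows "theta ^ m dvd F"
proof -
  \<comment> \<open>A group element that sends \<open>PY\<close> to a given line moves the hypothesis to that line.\<close>
  have line: "act h PY ^ m dvd F" if "h ** g = mat 1" for g h
  proof -
    have "act h (PY ^ m) dvd act h (act g F)" using assms by (rule act.hom_dvd)
    then show ?thesis by (simp add: act_act that act_mat_1 act.hom_power)
  qed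
  have "PX ^ m dvd F"
    using line[of "vector [vector [0, 1], vector [1, 0]]" "vector [vector [0, 1], vector [1, 0]]"]
    by (simp add: act_PY const_hom_simps vec_eq_iff forall_2 matrix_matrix_mult_def sum_2 mat_def)
  moreover have "(PY - const c * PX) ^ m dvd F" for c
    using line[of "vector [vector [1, - c], vector [0, 1]]" "vector [vector [1, c], vector [0, 1]]"]
    by (simp add: act_PY const_hom_simps vec_eq_iff forall_2 matrix_matrix_mult_def sum_2 mat_def)
  then have "(\<Prod>c\<in>UNIV. (PY - const c * PX) ^ m) dvd F"
    by (intro prod_dvd_of_pairwise_coprime) (auto simp: coprime_lines)
  moreover have "coprime (PX ^ m) (\<Prod>c\<in>UNIV. (PY - const c * PX :: 'p bipoly) ^ m)"
    by (intro prod_coprime_right) (simp add: coprime_PX_line)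
  ultimately have "PX ^ m * (\<Prod>c\<in>UNIV. (PY - const c * PX) ^ m) dvd F"
    by (simp add: divides_mult)
  moreover have "theta ^ m = (- 1) ^ m * (PX ^ m * (\<Prod>c\<in>UNIV. (PY - const c * (PX :: 'p bipoly)) ^ m))"
    unfolding theta_eq_prod by (subst power_minus) (simp add: power_mult_distrib prod_power_distrib)
  moreover have "is_unit ((- 1 :: 'p bipoly) ^ m)" by (simp add: is_unit_power_iff)
  ultimately show ?thesis by (simp add: mult_unit_dvd_iff')
qed

lemma act_theta:
  "act g theta = const (g $ 1 $ 1 * g $ 2 $ 2 - g $ 1 $ 2 * g $ 2 $ 1) * (theta :: 'p::prime_card bipoly)"
  unfolding theta_def act.hom_minus act.hom_mult act.hom_power act_PX act_PY frobenius_linear_form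
  by (simp add: const.hom_minus const.hom_mult algebra_simps)

lemma theta_power_dvd_act: "theta ^ m dvd F \<Longrightarrow> theta ^ m dvd act g F"
proof -
  assume "theta ^ m dvd F"
  then have "act g (theta ^ m) dvd act g F" by (rule act.hom_dvd)
  moreover have "theta ^ m dvd act g (theta ^ m)"
    by (simp add: act.hom_power act_theta power_mult_distrib)
  ultimately show ?thesis by (rule dvd_trans[rotated])
qed

lemma PY_dvd_theta: "PY dvd (theta :: 'p::prime_card bipoly)"
  unfolding theta_def by (intro dvd_diff dvd_mult dvd_power dvd_triv_right) simp

text \<open>
  Since \<open>theta\<close> is, up to sign, the product of the lines through the rational points of the projective line and
  the group permutes these transitively, divisibility by \<open>theta ^ m\<close> is a condition at the single
  line \<open>Y = 0\<close>, imposed on all translates of \<open>F\<close>.  Singular matrices may be included because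
  \<open>act g theta\<close> is \<open>det g\<close> times \<open>theta\<close>.
\<close>

lemma theta_power_dvd_iff: "theta ^ m dvd F \<longleftrightarrow> (\<forall>g. PY ^ m dvd act g F)"
  using theta_power_dvdI theta_power_dvd_act dvd_power_same[OF PY_dvd_theta] dvd_trans by blast

section \<open>Submodules and their cosets\<close>

lemma is_submoduleD:
  assumes "is_submodule U"
  shows "0 \<in> U" "F \<in> U \<Longrightarrow> G \<in> U \<Longrightarrow> F + G \<in> U" "F \<in> U \<Longrightarrow> const c * F \<in> U"
    "g \<in> GL2 \<Longrightarrow> F \<in> U \<Longrightarrow> act g F \<in> U"
  using assms by (auto simp: is_submodule_def)

lemma is_submodule_diff:
  assumes "is_submodule U" "F \<in> U" "G \<in> U"
  shows "F - G \<in> U"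
  using is_submoduleD(2)[OF assms(1,2) is_submoduleD(3)[OF assms(1,3), of "-1"]]
  by (simp add: const_hom_simps)

lemma is_submodule_Int: "is_submodule U \<Longrightarrow> is_submodule W \<Longrightarrow> is_submodule (U \<inter> W)"
  by (auto simp: is_submodule_def)

lemma is_submodule_set_plus:
  assumes "is_submodule U" "is_submodule W"
  shows "is_submodule (U + W)"
  unfolding is_submodule_def
proof (intro conjI ballI allI)
  show "0 \<in> U + W"
    using set_plus_intro[OF is_submoduleD(1)[OF assms(1)] is_submoduleD(1)[OF assms(2)]] by simp
next
  fix F G assume "F \<in> U + W" "G \<in> U + W"
  then obtain u w u' w' where "F = u + w" "G = u' + w'" "u \<in> U" "w \<in> W" "u' \<in> U" "w' \<in> W"
    by (auto elim!: set_plus_elim)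
  moreover from this have "F + G = (u + u') + (w + w')" by (simp add: algebra_simps)
  ultimately show "F + G \<in> U + W"
    by (metis set_plus_intro is_submoduleD(2) assms)
next
  fix c F assume "F \<in> U + W"
  then show "const c * F \<in> U + W"
    by (auto elim!: set_plus_elim simp: distrib_left
        intro!: set_plus_intro is_submoduleD(3)[OF assms(1)] is_submoduleD(3)[OF assms(2)])
next
  fix g :: "'a mat2" and F assume "g \<in> GL2" "F \<in> U + W"
  then show "act g F \<in> U + W"
    by (auto elim!: set_plus_elim simp: act.hom_add
        intro!: set_plus_intro is_submoduleD(4)[OF assms(1)] is_submoduleD(4)[OF assms(2)])
qed

lemma is_submodule_Vhom: "is_submodule (Vhom r)"
  by (simp add: is_submodule_def Vhom_0 Vhom_add Vhom_const_mult Vhom_act)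

lemma is_submodule_Vdiv: "is_submodule (Vdiv r m)"
  by (auto simp: is_submodule_def Vdiv_def Vhom_0 Vhom_add Vhom_const_mult Vhom_act theta_power_dvd_act)

lemma Xsub_least:
  "is_submodule U \<Longrightarrow> U \<subseteq> Vhom r \<Longrightarrow> PX ^ (r - i) * PY ^ i \<in> U \<Longrightarrow> Xsub r i \<subseteq> U"
  unfolding Xsub_def by (rule hull_minimal) auto

lemma Xsub_generator: "PX ^ (r - i) * PY ^ i \<in> Xsub r i"
  using hull_subset unfolding Xsub_def by fast

lemma Xsub_subset_Vhom: "i \<le> r \<Longrightarrow> Xsub r i \<subseteq> Vhom r"
  using Vhom_monomial[of "r - i" i] by (intro Xsub_least is_submodule_Vhom) auto

lemma is_submodule_Xsub: "is_submodule (Xsub r i)"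
  unfolding Xsub_def hull_def is_submodule_def by auto

lemma is_submodule_Xdiv: "is_submodule (Xdiv r i m)"
  unfolding Xdiv_def by (intro is_submodule_Int is_submodule_Xsub is_submodule_Vdiv)

lemma elt_set_plus_eq_image: "F +o W = (+) F ` W"
  by (auto simp: elt_set_plus_def)

lemma coset_eq_iff:
  assumes "is_submodule W"
  shows "F +o W = G +o W \<longleftrightarrow> F - G \<in> W"
proof
  assume "F +o W = G +o W"
  then have "F \<in> G +o W" using set_plus_intro2[OF is_submoduleD(1)[OF assms], of F] by simp
  then show "F - G \<in> W" by (rule set_plus_imp_minus)
next
  assume d: "F - G \<in> W"
  have "x \<in> F +o W \<longleftrightarrow> x \<in> G +o W" for x
    unfolding set_minus_plus[symmetric]
    using is_submoduleD(2)[OF assms _ d, of "x - F"] is_submodule_diff[OF assms _ d, of "x - G"]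
    by auto
  then show "F +o W = G +o W" by blast
qed

lemma submodule_plus_self:
  assumes "is_submodule W"
  shows "W + W = W"
proof
  show "W + W \<subseteq> W" by (auto elim!: set_plus_elim intro: is_submoduleD(2)[OF assms])
  show "W \<subseteq> W + W" by (rule set_zero_plus2) (rule is_submoduleD(1)[OF assms])
qed

lemma coset_add: "is_submodule W \<Longrightarrow> (F +o W) + (G +o W) = (F + G) +o W"
  by (simp add: set_plus_rearrange submodule_plus_self)

lemma coset_scale:
  assumes "is_submodule W"
  shows "(\<lambda>F. const c * F) ` (F +o W) + W = (const c * F) +o W"
proof -
  have "(\<lambda>F. const c * F) ` (F +o W) = (const c * F) +o ((\<lambda>F. const c * F) ` W)"
    by (simp add: elt_set_plus_eq_image image_image distrib_left)
  moreover have "(\<lambda>F. const c * F) ` W + W = W"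
  proof
    show "(\<lambda>F. const c * F) ` W + W \<subseteq> W"
      by (auto elim!: set_plus_elim intro: is_submoduleD(2,3)[OF assms])
    show "W \<subseteq> (\<lambda>F. const c * F) ` W + W"
      by (rule set_zero_plus2) (use is_submoduleD(1)[OF assms] in force)
  qed
  ultimately show ?thesis by (simp add: set_plus_rearrange3)
qed

lemma coset_act:
  assumes W: "is_submodule W" and g: "g \<in> GL2"
  shows "act g ` (F +o W) = act g F +o W"
proof -
  obtain h where h: "g ** h = mat 1" "h ** g = mat 1" using g by (auto simp: GL2_def invertible_def)
  then have "h \<in> GL2" by (auto simp: GL2_def invertible_def)
  have "act g ` W = W"
  proof
    show "act g ` W \<subseteq> W" using is_submoduleD(4)[OF W g] by blast
    show "W \<subseteq> act g ` W"
    proof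
      fix w assume "w \<in> W"
      then have "act h w \<in> W" by (rule is_submoduleD(4)[OF W \<open>h \<in> GL2\<close>])
      moreover have "w = act g (act h w)" by (simp add: act_act h act_mat_1)
      ultimately show "w \<in> act g ` W" by blast
    qed
  qed
  moreover have "act g ` (F +o W) = act g F +o (act g ` W)"
    by (simp add: elt_set_plus_eq_image image_image act.hom_add)
  ultimately show ?thesis by simp
qed

lemma monomial_leading:
  assumes "j \<le> r"
  shows "PX ^ (r - j) * PY ^ j \<in> Vhom r"
    and "coeff (PX ^ (r - j) * PY ^ j) j = Polynomial.monom 1 (r - j)"
    and "\<forall>l>j. coeff (PX ^ (r - j) * PY ^ j) l = 0"
  using Vhom_monomial[of "r - j" j] assms by (simp_all add: monomial_eq)

section \<open>Relations that are submodules of a product\<close>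

text \<open>
  A relation that is a submodule of the product of two modules is an isomorphism between
  subquotients as soon as it is total and onto on the larger submodules and matches the smaller
  ones.  Working with relations avoids a choice of representatives.
\<close>

locale submodule_relation =
  fixes R :: "'p::prime_card bipoly \<Rightarrow> 'p bipoly \<Rightarrow> bool"
  assumes R_zero: "R 0 0"
    and R_add: "\<And>F G F' G'. R F G \<Longrightarrow> R F' G' \<Longrightarrow> R (F + F') (G + G')"
    and R_scale: "\<And>c F G. R F G \<Longrightarrow> R (const c * F) (const c * G)"
    and R_act: "\<And>g F G. g \<in> GL2 \<Longrightarrow> R F G \<Longrightarrow> R (act g F) (act g G)"
begin

lemma R_diff: "R F G \<Longrightarrow> R F' G' \<Longrightarrow> R (F - F') (G - G')"
  using R_add[of F G "const (-1) * F'" "const (-1) * G'"] R_scale[of F' G' "-1"]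
  by (simp add: const_hom_simps)

lemma is_submodule_preimage:
  assumes X: "is_submodule X"
  shows "is_submodule {F. \<exists>G\<in>X. R F G}"
  unfolding is_submodule_def
proof (intro conjI ballI allI)
  show "0 \<in> {F. \<exists>G\<in>X. R F G}" using is_submoduleD(1)[OF X] R_zero by blast
next
  fix F G assume "F \<in> {F. \<exists>G\<in>X. R F G}" "G \<in> {F. \<exists>G\<in>X. R F G}"
  then obtain F' G' where "F' \<in> X" "R F F'" "G' \<in> X" "R G G'" by blast
  then have "F' + G' \<in> X" "R (F + G) (F' + G')" using is_submoduleD(2)[OF X] R_add by simp_all
  then show "F + G \<in> {F. \<exists>G\<in>X. R F G}" by blast
next
  fix c F assume "F \<in> {F. \<exists>G\<in>X. R F G}"
  then obtain F' where "F' \<in> X" "R F F'" by blast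
  then have "const c * F' \<in> X" "R (const c * F) (const c * F')" using is_submoduleD(3)[OF X] R_scale by simp_all
  then show "const c * F \<in> {F. \<exists>G\<in>X. R F G}" by blast
next
  fix g :: "'p mat2" and F assume g: "g \<in> GL2" and "F \<in> {F. \<exists>G\<in>X. R F G}"
  then obtain F' where "F' \<in> X" "R F F'" by blast
  then have "act g F' \<in> X" "R (act g F) (act g F')" using is_submoduleD(4)[OF X g] R_act[OF g] by simp_all
  then show "act g F \<in> {F. \<exists>G\<in>X. R F G}" by blast
qed
text \<open>
  The elements of \<open>Vhom r\<close> that are related to something in \<open>Xsub s i\<close> form a submodule, so it suffices to
  look at the generator.
\<close>

lemma Xsub_related:
  assumes gen: "R (PX ^ (r - i) * PY ^ i) (PX ^ (s - i) * PY ^ i)"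
    and "i \<le> r" and F: "F \<in> Xsub r i"
  shows "\<exists>G\<in>Xsub s i. R F G"
proof -
  have "is_submodule ({F. \<exists>G\<in>Xsub s i. R F G} \<inter> Vhom r)"
    by (intro is_submodule_Int is_submodule_preimage is_submodule_Xsub is_submodule_Vhom)
  then have "Xsub r i \<subseteq> {F. \<exists>G\<in>Xsub s i. R F G} \<inter> Vhom r"
    using gen Xsub_generator[of s i] monomial_leading(1)[OF \<open>i \<le> r\<close>] by (intro Xsub_least) auto
  then show ?thesis using F by blast
qed

text \<open>
  The isomorphism sends a coset of \<open>W\<close> to the set of all elements of \<open>U'\<close> that are related to some member
  of it.  Subtracting related pairs and using \<open>W_iff\<close> shows that this set is a single coset of \<open>W'\<close>.
\<close>

lemma quot_isomorphic:
  assumes U: "is_submodule U" "is_submodule W" "W \<subseteq> U"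
    and U': "is_submodule U'" "is_submodule W'" "W' \<subseteq> U'"
    and total: "\<And>F. F \<in> U \<Longrightarrow> \<exists>G\<in>U'. R F G"
    and onto: "\<And>G. G \<in> U' \<Longrightarrow> \<exists>F\<in>U. R F G"
    and W_iff: "\<And>F G. F \<in> U \<Longrightarrow> G \<in> U' \<Longrightarrow> R F G \<Longrightarrow> F \<in> W \<longleftrightarrow> G \<in> W'"
  shows "quot U W \<cong>\<^sub>\<Gamma> quot U' W'"
proof -
  define \<phi> where "\<phi> C = {G \<in> U'. \<exists>F\<in>C. R F G}" for C
  have diff_iff: "F - F' \<in> W \<longleftrightarrow> G - G' \<in> W'"
    if "F \<in> U" "G \<in> U'" "R F G" "F' \<in> U" "G' \<in> U'" "R F' G'" for F G F' G'
    using that by (intro W_iff R_diff is_submodule_diff[OF U(1)] is_submodule_diff[OF U'(1)])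
  have \<phi>: "\<phi> (F +o W) = G +o W'" if F: "F \<in> U" and G: "G \<in> U'" and R: "R F G" for F G
  proof (intro equalityI subsetI)
    fix G' assume "G' \<in> \<phi> (F +o W)"
    then obtain F' where F': "G' \<in> U'" "F' \<in> F +o W" "R F' G'" by (auto simp: \<phi>_def)
    have "F' - F \<in> W" using F'(2) by (rule set_plus_imp_minus)
    moreover from this have "F' \<in> U"
      using is_submoduleD(2)[OF U(1) F, of "F' - F"] U(3) by auto
    ultimately have "G' - G \<in> W'" using diff_iff[of F' G' F G] F G R F' by blast
    then show "G' \<in> G +o W'" by (rule set_minus_imp_plus)
  next
    fix G' assume "G' \<in> G +o W'"
    then have d: "G' - G \<in> W'" by (rule set_plus_imp_minus)
    then have G': "G' \<in> U'" using is_submoduleD(2)[OF U'(1) G, of "G' - G"] U'(3) by auto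
    obtain F' where F': "F' \<in> U" "R F' G'" using onto[OF G'] by blast
    have "F' - F \<in> W" using d diff_iff[of F' G' F G] F G R F' G' by blast
    then show "G' \<in> \<phi> (F +o W)" using F' G' by (auto simp: \<phi>_def dest: set_minus_imp_plus)
  qed
  have \<phi>': "\<exists>F\<in>U. \<exists>G\<in>U'. R F G \<and> C = F +o W \<and> \<phi> C = G +o W'" if C: "C \<in> gcarrier (quot U W)" for C
  proof -
    obtain F where F: "F \<in> U" "C = F +o W" using C by (auto simp: quot_def)
    obtain G where "G \<in> U'" "R F G" using total[OF F(1)] by blast
    then show ?thesis using F \<phi> by blast
  qed
  have "gmodule_iso (quot U W) (quot U' W') \<phi>"
    unfolding gmodule_iso_def
  proof (intro conjI ballI allI)
    show "bij_betw \<phi> (gcarrier (quot U W)) (gcarrier (quot U' W'))"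
    proof (rule bij_betw_imageI)
      show "inj_on \<phi> (gcarrier (quot U W))"
      proof (rule inj_onI)
        fix C D assume C: "C \<in> gcarrier (quot U W)" and D: "D \<in> gcarrier (quot U W)" and eq: "\<phi> C = \<phi> D"
        obtain F G where F: "F \<in> U" "G \<in> U'" "R F G" "C = F +o W" "\<phi> C = G +o W'" using \<phi>'[OF C] by blast
        obtain F' G' where F': "F' \<in> U" "G' \<in> U'" "R F' G'" "D = F' +o W" "\<phi> D = G' +o W'" using \<phi>'[OF D] by blast
        show "C = D" using eq F F' diff_iff[of F G F' G'] by (simp add: coset_eq_iff U(2) U'(2))
      qed
      show "\<phi> ` gcarrier (quot U W) = gcarrier (quot U' W')"
      proof
        show "\<phi> ` gcarrier (quot U W) \<subseteq> gcarrier (quot U' W')"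
        proof
          fix D assume "D \<in> \<phi> ` gcarrier (quot U W)"
          then obtain G where "G \<in> U'" "D = G +o W'" using \<phi>' by blast
          then show "D \<in> gcarrier (quot U' W')" by (simp add: quot_def)
        qed
        show "gcarrier (quot U' W') \<subseteq> \<phi> ` gcarrier (quot U W)"
        proof
          fix D assume "D \<in> gcarrier (quot U' W')"
          then obtain G where G: "G \<in> U'" "D = G +o W'" by (auto simp: quot_def)
          obtain F where "F \<in> U" "R F G" using onto[OF G(1)] by blast
          then show "D \<in> \<phi> ` gcarrier (quot U W)" using \<phi>[of F G] G by (auto simp: quot_def)
        qed
      qed
    qed
  next
    fix C D assume C: "C \<in> gcarrier (quot U W)" and D: "D \<in> gcarrier (quot U W)"
    obtain F G where F: "F \<in> U" "G \<in> U'" "R F G" "C = F +o W" "\<phi> C = G +o W'" using \<phi>'[OF C] by blast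
    obtain F' G' where F': "F' \<in> U" "G' \<in> U'" "R F' G'" "D = F' +o W" "\<phi> D = G' +o W'" using \<phi>'[OF D] by blast
    have "\<phi> ((F + F') +o W) = (G + G') +o W'"
      using F F' by (intro \<phi> R_add is_submoduleD[OF U(1)] is_submoduleD[OF U'(1)])
    then show "\<phi> (gadd (quot U W) C D) = gadd (quot U' W') (\<phi> C) (\<phi> D)"
      unfolding F(5) F'(5) by (simp add: quot_def F(4) F'(4) coset_add U(2) U'(2))
  next
    fix c C assume C: "C \<in> gcarrier (quot U W)"
    obtain F G where F: "F \<in> U" "G \<in> U'" "R F G" "C = F +o W" "\<phi> C = G +o W'" using \<phi>'[OF C] by blast
    have "\<phi> ((const c * F) +o W) = (const c * G) +o W'"
      using F by (intro \<phi> R_scale is_submoduleD[OF U(1)] is_submoduleD[OF U'(1)])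
    then show "\<phi> (gscale (quot U W) c C) = gscale (quot U' W') c (\<phi> C)"
      unfolding F(5) by (simp add: quot_def F(4) coset_scale U(2) U'(2))
  next
    fix g :: "'p mat2" and C assume g: "g \<in> GL2" and C: "C \<in> gcarrier (quot U W)"
    obtain F G where F: "F \<in> U" "G \<in> U'" "R F G" "C = F +o W" "\<phi> C = G +o W'" using \<phi>'[OF C] by blast
    have "\<phi> (act g F +o W) = act g G +o W'"
      using F by (intro \<phi> R_act is_submoduleD[OF U(1)] is_submoduleD[OF U'(1)] g)
    then show "\<phi> (gact (quot U W) g C) = gact (quot U' W') g (\<phi> C)"
      unfolding F(5) by (simp add: quot_def F(4) coset_act U(2) U'(2) g)
  qed
  then show ?thesis by (auto simp: gmodule_isomorphic_def)
qed

lemma submodule_relation_converse: "submodule_relation (\<lambda>G F. R F G)"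
  by unfold_locales (fact R_zero | rule R_add R_scale R_act; assumption)+

end

section \<open>Comparing two degrees at every rational line\<close>

text \<open>
  \<open>G\<close>, of degree \<open>k\<close> more than \<open>F\<close>, agrees with \<open>u ^ k * F\<close> modulo \<open>l ^ m\<close> at every rational line
  \<open>l\<close>, where \<open>u\<close> is a linear form independent of \<open>l\<close>.  For \<open>l\<close> the image of \<open>Y\<close> under an invertible
  \<open>h\<close>, one takes \<open>u\<close> to be the image of \<open>X\<close> and reads the condition at \<open>Y\<close> by applying \<open>g\<close>, the inverse
  of \<open>h\<close>.  Quantifying over all matrices makes the relation stable under \<open>act\<close> by definition.
\<close>

definition loc_rel :: "nat \<Rightarrow> nat \<Rightarrow> 'p::prime_card bipoly \<Rightarrow> 'p bipoly \<Rightarrow> bool" where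
  "loc_rel m k F G \<longleftrightarrow> (\<forall>g. PY ^ m dvd act g G - PX ^ k * act g F)"

lemma loc_rel_add:
  assumes "loc_rel m k F G" "loc_rel m k F' G'"
  shows "loc_rel m k (F + F') (G + G')"
  unfolding loc_rel_def
proof
  fix g
  have "PY ^ m dvd (act g G - PX ^ k * act g F) + (act g G' - PX ^ k * act g F')"
    using assms by (simp add: loc_rel_def)
  then show "PY ^ m dvd act g (G + G') - PX ^ k * act g (F + F')"
    by (simp add: act.hom_add algebra_simps)
qed

lemma loc_rel_const_mult:
  assumes "loc_rel m k F G"
  shows "loc_rel m k (const c * F) (const c * G)"
  unfolding loc_rel_def
proof
  fix g
  have "PY ^ m dvd const c * (act g G - PX ^ k * act g F)"
    using assms by (simp add: loc_rel_def)
  then show "PY ^ m dvd act g (const c * G) - PX ^ k * act g (const c * F)"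
    by (simp add: act.hom_mult act_const algebra_simps)
qed

lemma loc_rel_act: "loc_rel m k F G \<Longrightarrow> loc_rel m k (act g F) (act g G)"
  by (simp add: loc_rel_def act_act)

lemma loc_rel_submodule_relation: "submodule_relation (loc_rel m k)"
  by unfold_locales (simp add: loc_rel_def, auto intro: loc_rel_add loc_rel_const_mult loc_rel_act)

lemma loc_rel_0_left: "loc_rel m k 0 G \<longleftrightarrow> theta ^ m dvd G"
  by (simp add: loc_rel_def theta_power_dvd_iff)

lemma PY_power_dvd_PX_mult: "PY ^ n dvd PX ^ k * F \<longleftrightarrow> PY ^ n dvd (F :: 'p::prime_card bipoly)"
  by (rule coprime_dvd_mult_right_iff) (simp add: coprime_PX_PY coprime_commute)

lemma loc_rel_theta_power_dvd_iff:
  assumes R: "loc_rel m k F G" and "n \<le> m"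
  shows "theta ^ n dvd F \<longleftrightarrow> theta ^ n dvd G"
proof -
  have "PY ^ n dvd act g F \<longleftrightarrow> PY ^ n dvd act g G" for g
  proof -
    have "PY ^ n dvd act g G - PX ^ k * act g F"
      using R \<open>n \<le> m\<close> unfolding loc_rel_def by (blast intro: dvd_trans le_imp_power_dvd)
    then have "PY ^ n dvd act g G \<longleftrightarrow> PY ^ n dvd PX ^ k * act g F"
      by (metis dvd_diff_left_iff dvd_diff_right_iff)
    then show ?thesis by (simp add: PY_power_dvd_PX_mult)
  qed
  then show ?thesis by (simp add: theta_power_dvd_iff)
qed

text \<open>
  These pairs and the pairs of \<open>0\<close> with the multiples of \<open>theta ^ m\<close> generate enough of the relation.  At each line other than \<open>Z\<close>, the form \<open>Z\<close> can play the role of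
  \<open>u\<close>; at the line \<open>Z\<close> both sides vanish to order \<open>m\<close>.
\<close>

lemma loc_rel_mult_power:
  fixes Z :: "'p::prime_card bipoly"
  assumes k: "CARD('p) * (CARD('p) - 1) dvd k" and m: "m \<le> CARD('p)"
    and Z: "Z = PX \<or> Z = PY" and F: "Z ^ m dvd F"
  shows "loc_rel m k F (Z ^ k * F)"
  unfolding loc_rel_def
proof
  fix g
  obtain a c where L: "act g Z = const a * PX + const c * PY"
    using Z act_PX act_PY by metis
  have "PY ^ m dvd (act g Z ^ k - PX ^ k) * act g Z ^ m"
    unfolding L by (rule linear_form_power_cong[OF k m])
  moreover have "act g Z ^ m dvd act g F"
    using act.hom_dvd[OF F, of g] by (simp add: act.hom_power)
  ultimately have "PY ^ m dvd (act g Z ^ k - PX ^ k) * act g F"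
    by (meson dvd_refl dvd_trans mult_dvd_mono)
  then show "PY ^ m dvd act g (Z ^ k * F) - PX ^ k * act g F"
    by (simp add: act.hom_mult act.hom_power algebra_simps)
qed


text \<open>
  The sign makes the leading coefficient in \<open>Y\<close> equal to a power of \<open>X\<close>, in the form that
  \<open>Vhom_leading_induct\<close> expects.
\<close>

lemma theta_power_monomial:
  fixes m a b :: nat
  defines "T \<equiv> (- 1) ^ m * theta ^ m * PX ^ a * (PY :: 'p::prime_card bipoly) ^ b"
  shows "coeff T (m * CARD('p) + b) = Polynomial.monom 1 (m + a)"
    and "l > m * CARD('p) + b \<Longrightarrow> coeff T l = 0"
    and "T \<in> Vhom (m * (CARD('p) + 1) + a + b)"
proof -
  let ?p = "CARD('p)"
  have p1: "?p > 1" using prime_card prime_gt_1_nat by blast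
  define t :: "'p bipoly" where "t = - theta"
  have th: "t = (Polynomial.monom (Polynomial.monom 1 1) ?p - Polynomial.monom (Polynomial.monom 1 ?p) 1 :: 'p bipoly)"
    using monomial_eq[where 'p = 'p, of 1 ?p] monomial_eq[where 'p = 'p, of ?p 1] by (simp add: t_def theta_def)
  have lc: "coeff t ?p = (Polynomial.monom 1 1 :: 'p mod_ring poly)"
    using p1 unfolding th by simp
  have "degree t \<le> ?p" unfolding th
    by (rule degree_diff_le) (use p1 in \<open>auto intro: order.trans[OF degree_monom_le]\<close>)
  moreover have "?p \<le> degree t"
    by (rule le_degree) (simp add: lc)
  ultimately have deg: "degree t = ?p" by simp
  have T: "T = t ^ m * Polynomial.monom (Polynomial.monom 1 a) b"
    using monomial_eq[where 'p = 'p, of a b] by (simp add: T_def t_def power_minus[of theta] mult.assoc)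
  have nz: "t \<noteq> 0" using deg p1 by auto
  have degT: "degree T = m * ?p + b"
    unfolding T using nz by (subst degree_mult_eq) (auto simp: degree_power_eq deg degree_monom_eq)
  have "lead_coeff T = lead_coeff t ^ m * Polynomial.monom 1 a"
    unfolding T by (simp only: lead_coeff_mult lead_coeff_power lead_coeff_monom)
  then show "coeff T (m * ?p + b) = Polynomial.monom 1 (m + a)"
    unfolding degT deg lc by (simp add: monom_power mult_monom)
  show "l > m * ?p + b \<Longrightarrow> coeff T l = 0"
    by (rule coeff_eq_0) (simp add: degT)
  have "t \<in> Vhom (?p + 1)"
    using Vhom_diff[OF Vhom_monomial[of 1 ?p] Vhom_monomial[of ?p 1, unfolded add.commute[of ?p]]]
    by (simp add: t_def theta_def)
  from Vhom_mult[OF Vhom_power[OF this, of m] Vhom_monomial[of a b]]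
  show "T \<in> Vhom (m * (?p + 1) + a + b)"
    unfolding T monomial_eq by (simp add: add.assoc)
qed

text \<open>
  The bound on \<open>s\<close> makes each monomial of degree \<open>s\<close> divisible by \<open>X ^ m\<close> or by \<open>Y ^ m\<close>.
\<close>

lemma loc_rel_total:
  fixes F :: "'p::prime_card bipoly"
  assumes k: "CARD('p) * (CARD('p) - 1) dvd k" and m: "m \<le> CARD('p)" and s: "2 * m \<le> s + 1"
    and F: "F \<in> Vhom s"
  shows "\<exists>G\<in>Vhom (s + k). loc_rel m k F G"
proof -
  have "Vhom s \<subseteq> {F. \<exists>G\<in>Vhom (s + k). loc_rel m k F (G :: 'p bipoly)}" (is "_ \<subseteq> ?S")
  proof (rule Vhom_leading_induct)
    fix j assume j: "j \<le> s"
    let ?H = "PX ^ (s - j) * PY ^ j :: 'p bipoly"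
    have ex: "\<exists>Z. (Z = PX \<or> Z = PY) \<and> Z ^ m dvd ?H"
    proof (cases "m \<le> j")
      case True
      then show ?thesis by (intro exI[of _ PY]) (simp add: le_imp_power_dvd)
    next
      case False
      then have "m \<le> s - j" using s by linarith
      then show ?thesis by (intro exI[of _ PX]) (simp add: le_imp_power_dvd)
    qed
    then obtain Z where Z: "Z = PX \<or> Z = PY" "Z ^ m dvd ?H" by blast
    have "Z \<in> Vhom 1" using Z(1) Vhom_PX Vhom_PY by blast
    then have "Z ^ k * ?H \<in> Vhom (k * 1 + s)"
      by (intro Vhom_mult Vhom_power monomial_leading j)
    then have "?H \<in> ?S" using loc_rel_mult_power[OF k m Z] by (auto simp: add.commute)
    then show "\<exists>H\<in>?S \<inter> Vhom s. coeff H j = Polynomial.monom 1 (s - j) \<and> (\<forall>l>j. coeff H l = 0)"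
      using monomial_leading[OF j] by blast
  next
    show "0 \<in> ?S" using Vhom_0 loc_rel_0_left[of m k 0] by auto
  next
    fix F F' :: "'p bipoly" assume "F \<in> ?S" "F' \<in> ?S"
    then show "F + F' \<in> ?S" using Vhom_add loc_rel_add by blast
  next
    fix c and F :: "'p bipoly" assume "F \<in> ?S"
    then show "const c * F \<in> ?S" using Vhom_const_mult loc_rel_const_mult by blast
  qed
  then show ?thesis using F by blast
qed

text \<open>
  A monomial \<open>X ^ (s + k - j) * Y ^ j\<close> is \<open>X ^ k\<close> times a multiple of \<open>X ^ m\<close>, or \<open>Y ^ k\<close> times a
  multiple of \<open>Y ^ m\<close>, unless \<open>j\<close> lies in a middle range.  There the bound on \<open>s\<close> gives \<open>j \<ge> m p\<close> and
  \<open>s + k - j \<ge> m\<close>, so \<open>j\<close> is the degree in \<open>Y\<close> of a multiple of \<open>theta ^ m\<close>, and such a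
  multiple is related to \<open>0\<close>.
\<close>

lemma loc_rel_onto:
  fixes G :: "'p::prime_card bipoly"
  assumes k: "CARD('p) * (CARD('p) - 1) dvd k" and m: "m \<le> CARD('p)"
    and s: "m * (CARD('p) + 1) \<le> s + 1" and G: "G \<in> Vhom (s + k)"
  shows "\<exists>F\<in>Vhom s. loc_rel m k F G"
proof -
  let ?p = "CARD('p)"
  have "Vhom (s + k) \<subseteq> {G. \<exists>F\<in>Vhom s. loc_rel m k (F :: 'p bipoly) G}" (is "_ \<subseteq> ?S")
  proof (rule Vhom_leading_induct)
    fix j assume j: "j \<le> s + k"
    let ?H = "PX ^ (s + k - j) * PY ^ j :: 'p bipoly"
    show "\<exists>H\<in>?S \<inter> Vhom (s + k). coeff H j = Polynomial.monom 1 (s + k - j) \<and> (\<forall>l>j. coeff H l = 0)"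
    proof (cases "j + m \<le> s \<or> k + m \<le> j")
      case True
      then have "\<exists>F\<in>Vhom s. loc_rel m k F ?H"
      proof
        assume le: "j + m \<le> s"
        have "loc_rel m k (PX ^ (s - j) * (PY :: 'p bipoly) ^ j) (PX ^ k * (PX ^ (s - j) * PY ^ j))"
          by (rule loc_rel_mult_power[OF k m]) (use le in \<open>simp_all add: le_imp_power_dvd\<close>)
        moreover have "PX ^ k * (PX ^ (s - j) * PY ^ j) = ?H"
          using le by (simp add: mult.assoc[symmetric] power_add[symmetric] add.commute)
        ultimately show ?thesis using le monomial_leading(1)[of j s] by auto
      next
        assume ge: "k + m \<le> j"
        have "loc_rel m k (PX ^ (s + k - j) * (PY :: 'p bipoly) ^ (j - k)) (PY ^ k * (PX ^ (s + k - j) * PY ^ (j - k)))"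
          by (rule loc_rel_mult_power[OF k m]) (use ge in \<open>simp_all add: le_imp_power_dvd\<close>)
        moreover have "PY ^ k * (PX ^ (s + k - j) * PY ^ (j - k)) = ?H"
          using ge by (simp add: mult.left_commute power_add[symmetric])
        ultimately show ?thesis using ge j Vhom_monomial[of "s + k - j" "j - k"] by auto
      qed
      then show ?thesis using monomial_leading[OF j] by blast
    next
      case False
      have "m \<le> m * ?p" "m * (?p + 1) = m * ?p + m" by simp_all
      then have "m * ?p \<le> j" "m \<le> s + k - j" using False s by linarith+
      define T :: "'p bipoly" where
        "T = (- 1) ^ m * theta ^ m * PX ^ (s + k - j - m) * PY ^ (j - m * ?p)"
      have "theta ^ m dvd T" by (simp add: T_def)
      then have "T \<in> ?S" using Vhom_0 loc_rel_0_left by blast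
      moreover have "T \<in> Vhom (s + k)"
        using theta_power_monomial(3)[where 'p = 'p, of m "s + k - j - m" "j - m * ?p"]
          \<open>m * ?p \<le> j\<close> \<open>m \<le> s + k - j\<close> j by (simp add: T_def algebra_simps)
      moreover have "coeff T j = Polynomial.monom 1 (s + k - j)" "\<forall>l>j. coeff T l = 0"
        using theta_power_monomial(1)[where 'p = 'p, of m "s + k - j - m" "j - m * ?p"]
          theta_power_monomial(2)[where 'p = 'p and m = m and a = "s + k - j - m" and b = "j - m * ?p"]
          le_add_diff_inverse[OF \<open>m * ?p \<le> j\<close>] le_add_diff_inverse[OF \<open>m \<le> s + k - j\<close>]
        unfolding T_def by metis+
      ultimately show ?thesis by blast
    qed
  next
    show "0 \<in> ?S" using Vhom_0 loc_rel_0_left[of m k 0] by auto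
  next
    fix F F' :: "'p bipoly" assume "F \<in> ?S" "F' \<in> ?S"
    then show "F + F' \<in> ?S" using Vhom_add loc_rel_add by blast
  next
    fix c and F :: "'p bipoly" assume "F \<in> ?S"
    then show "const c * F \<in> ?S" using Vhom_const_mult loc_rel_const_mult by blast
  qed
  then show ?thesis using G by blast
qed

section \<open>The periodic quotients\<close>

lemma Vdiv_antimono: "n \<le> m \<Longrightarrow> Vdiv r m \<subseteq> Vdiv r n"
  by (auto simp: Vdiv_def intro: dvd_trans le_imp_power_dvd)

context
  fixes k m s :: nat
  assumes k: "CARD('p::prime_card) * (CARD('p) - 1) dvd k" and m0: "0 < m" and m: "m \<le> CARD('p)"
    and s: "m * (CARD('p) + 1) \<le> s + 1"
begin

lemma Vhom_total: "F \<in> Vhom s \<Longrightarrow> \<exists>G\<in>Vhom (s + k). loc_rel m k F (G :: 'p bipoly)"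
proof (rule loc_rel_total[OF k m])
  have "2 * m \<le> m * (CARD('p) + 1)" using prime_card[where 'a = 'p] prime_ge_2_nat by (simp add: mult.commute)
  then show "2 * m \<le> s + 1" using s by linarith
qed

lemma Vhom_onto: "G \<in> Vhom (s + k) \<Longrightarrow> \<exists>F\<in>Vhom s. loc_rel m k F (G :: 'p bipoly)"
  by (rule loc_rel_onto[OF k m s])

text \<open>
  The bound on \<open>s\<close> leaves room for the factor \<open>X ^ m\<close> in the generator \<open>X ^ (s - i) * Y ^ i\<close>, so
  multiplying it by \<open>X ^ k\<close> gives its partner, which is the generator in degree \<open>s + k\<close>.
\<close>

lemma generator_rel:
  assumes i: "i \<le> CARD('p) - 1"
  shows "i \<le> s" "loc_rel m k (PX ^ (s - i) * PY ^ i) (PX ^ (s + k - i) * (PY :: 'p bipoly) ^ i)"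
proof -
  have "i < CARD('p)" using i prime_gt_0_nat[OF prime_card[where 'a = 'p]] by linarith
  moreover have "CARD('p) \<le> m * CARD('p)" "m * (CARD('p) + 1) = m * CARD('p) + m"
    using m0 by simp_all
  ultimately have *: "m + i \<le> s" using s by linarith
  then show "i \<le> s" by simp
  have "loc_rel m k (PX ^ (s - i) * PY ^ i) (PX ^ k * (PX ^ (s - i) * (PY :: 'p bipoly) ^ i))"
    by (rule loc_rel_mult_power[OF k m]) (use * in \<open>simp_all add: le_imp_power_dvd\<close>)
  moreover have "PX ^ k * (PX ^ (s - i) * PY ^ i) = PX ^ (s + k - i) * (PY :: 'p bipoly) ^ i"
    using * by (simp add: mult.assoc[symmetric] power_add[symmetric] add.commute)
  ultimately show "loc_rel m k (PX ^ (s - i) * PY ^ i) (PX ^ (s + k - i) * (PY :: 'p bipoly) ^ i)"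
    by simp
qed

lemma converse_relation: "submodule_relation (\<lambda>G F. loc_rel m k F G)"
  by (rule submodule_relation.submodule_relation_converse[OF loc_rel_submodule_relation])

lemma Xsub_total:
  assumes "i \<le> CARD('p) - 1" "F \<in> Xsub s i"
  shows "\<exists>G\<in>Xsub (s + k) i. loc_rel m k F (G :: 'p bipoly)"
  by (rule submodule_relation.Xsub_related[OF loc_rel_submodule_relation])
     (use generator_rel[OF assms(1)] assms(2) in auto)

lemma Xsub_onto:
  assumes "i \<le> CARD('p) - 1" "G \<in> Xsub (s + k) i"
  shows "\<exists>F\<in>Xsub s i. loc_rel m k F (G :: 'p bipoly)"
  by (rule submodule_relation.Xsub_related[OF converse_relation])
     (use generator_rel[OF assms(1)] assms(2) in auto)

lemma Vdiv_iff:
  "F \<in> Vhom s \<Longrightarrow> G \<in> Vhom (s + k) \<Longrightarrow> loc_rel m k F G \<Longrightarrow> n \<le> m \<Longrightarrow>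
    (G :: 'p bipoly) \<in> Vdiv (s + k) n \<longleftrightarrow> F \<in> Vdiv s n"
  using loc_rel_theta_power_dvd_iff[of m k F G n] by (simp add: Vdiv_def)

lemma Vdiv_quot_isomorphic:
  assumes "n \<le> m"
  shows "quot (Vdiv (s + k) n :: 'p bipoly set) (Vdiv (s + k) m) \<cong>\<^sub>\<Gamma> quot (Vdiv s n) (Vdiv s m)"
proof (intro submodule_relation.quot_isomorphic[OF converse_relation] is_submodule_Vdiv Vdiv_antimono assms)
  fix G :: "'p bipoly" assume G: "G \<in> Vdiv (s + k) n"
  then obtain F where "F \<in> Vhom s" "loc_rel m k F G" using Vhom_onto by (auto simp: Vdiv_def)
  then show "\<exists>F\<in>Vdiv s n. loc_rel m k F G"
    using G Vdiv_iff[OF _ _ _ assms] by (auto simp: Vdiv_def)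
next
  fix F :: "'p bipoly" assume F: "F \<in> Vdiv s n"
  then obtain G where "G \<in> Vhom (s + k)" "loc_rel m k F G" using Vhom_total by (auto simp: Vdiv_def)
  then show "\<exists>G\<in>Vdiv (s + k) n. loc_rel m k F G"
    using F Vdiv_iff[OF _ _ _ assms] by (auto simp: Vdiv_def)
next
  fix G F :: "'p bipoly"
  assume "G \<in> Vdiv (s + k) n" "F \<in> Vdiv s n" "loc_rel m k F G"
  then show "G \<in> Vdiv (s + k) m \<longleftrightarrow> F \<in> Vdiv s m"
    by (intro Vdiv_iff) (auto simp: Vdiv_def)
qed

lemma Xdiv_quot_isomorphic:
  assumes "n \<le> m" and i: "i \<le> CARD('p) - 1"
  shows "quot (Xdiv (s + k) i n :: 'p bipoly set) (Xdiv (s + k) i m) \<cong>\<^sub>\<Gamma>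
    quot (Xdiv s i n) (Xdiv s i m)"
proof (intro submodule_relation.quot_isomorphic[OF converse_relation] is_submodule_Xdiv)
  show "Xdiv r i m \<subseteq> (Xdiv r i n :: 'p bipoly set)" for r
    using Vdiv_antimono[OF assms(1)] by (auto simp: Xdiv_def)
  then show "Xdiv r i m \<subseteq> (Xdiv r i n :: 'p bipoly set)" for r .
next
  fix G :: "'p bipoly" assume G: "G \<in> Xdiv (s + k) i n"
  then obtain F where F: "F \<in> Xsub s i" "loc_rel m k F G" using Xsub_onto[OF i] by (auto simp: Xdiv_def)
  then have "F \<in> Vhom s" using Xsub_subset_Vhom generator_rel(1)[OF i] by blast
  then show "\<exists>F\<in>Xdiv s i n. loc_rel m k F G"
    using F G Vdiv_iff[OF _ _ _ assms(1)] by (auto simp: Xdiv_def Vdiv_def)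
next
  fix F :: "'p bipoly" assume F: "F \<in> Xdiv s i n"
  then obtain G where G: "G \<in> Xsub (s + k) i" "loc_rel m k F G" using Xsub_total[OF i] by (auto simp: Xdiv_def)
  then have "G \<in> Vhom (s + k)" using Xsub_subset_Vhom generator_rel(1)[OF i] trans_le_add1 by blast
  then show "\<exists>G\<in>Xdiv (s + k) i n. loc_rel m k F G"
    using F G Vdiv_iff[OF _ _ _ assms(1)] by (auto simp: Xdiv_def Vdiv_def)
next
  fix G F :: "'p bipoly"
  assume "G \<in> Xdiv (s + k) i n" "F \<in> Xdiv s i n" "loc_rel m k F G"
  then show "G \<in> Xdiv (s + k) i m \<longleftrightarrow> F \<in> Xdiv s i m"
    using Vdiv_iff[of F G m] by (auto simp: Xdiv_def Vdiv_def)
qed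

lemma Xsub_plus_Vdiv_quot_isomorphic:
  assumes i: "i \<le> CARD('p) - 1"
  shows "quot (Vhom (s + k) :: 'p bipoly set) (Xsub (s + k) i + Vdiv (s + k) m) \<cong>\<^sub>\<Gamma>
    quot (Vhom s) (Xsub s i + Vdiv s m)"
proof (intro submodule_relation.quot_isomorphic[OF converse_relation] is_submodule_Vhom is_submodule_set_plus
    is_submodule_Xsub is_submodule_Vdiv)
  have "i \<le> s" by (rule generator_rel(1)[OF i])
  have sub: "Xsub r i + Vdiv r m \<subseteq> (Vhom r :: 'p bipoly set)" if "i \<le> r" for r
    using Xsub_subset_Vhom[OF that] by (auto elim!: set_plus_elim simp: Vdiv_def intro: Vhom_add)
  show "Xsub (s + k) i + Vdiv (s + k) m \<subseteq> (Vhom (s + k) :: 'p bipoly set)"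
    and "Xsub s i + Vdiv s m \<subseteq> (Vhom s :: 'p bipoly set)"
    using \<open>i \<le> s\<close> by (simp_all add: sub)
  fix G F :: "'p bipoly"
  assume G: "G \<in> Vhom (s + k)" and F: "F \<in> Vhom s" and R: "loc_rel m k F G"
  have diff: "G - x' \<in> Vdiv (s + k) m \<longleftrightarrow> F - x \<in> Vdiv s m"
    if "x \<in> Xsub s i" "x' \<in> Xsub (s + k) i" "loc_rel m k x x'" for x x'
    using that Xsub_subset_Vhom[of i s] Xsub_subset_Vhom[of i "s + k"] \<open>i \<le> s\<close>
    by (intro Vdiv_iff Vhom_diff F G submodule_relation.R_diff[OF loc_rel_submodule_relation] R) auto
  \<comment> \<open>Membership in the sum is tested by subtracting related elements of the two \<open>Xsub\<close> parts.\<close>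
  have plus_iff: "H \<in> Xsub r i + Vdiv r m \<longleftrightarrow> (\<exists>x\<in>Xsub r i. H - x \<in> Vdiv r m)" for r and H :: "'p bipoly"
    by (auto elim!: set_plus_elim) (metis add_diff_cancel_left' diff_add_cancel add.commute set_plus_intro)+
  show "G \<in> Xsub (s + k) i + Vdiv (s + k) m \<longleftrightarrow> F \<in> Xsub s i + Vdiv s m"
    unfolding plus_iff using diff Xsub_total[OF i] Xsub_onto[OF i] by blast
qed (use Vhom_total Vhom_onto in auto)

end

lemma cong_obtain_add:
  fixes r s :: nat
  assumes "[r = s] (mod q)" "s \<le> r"
  obtains k where "r = s + k" "q dvd k"
  using assms by (metis cong_altdef_nat cong_sym le_add_diff_inverse)

theorem corollary4p2:
  fixes p :: nat
  assumes p: "p = CARD('p::prime_card)"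
  shows
    "(\<forall>n m i r s. n < m \<and> m \<le> p \<and> i \<le> p - 1 \<and> s \<le> r \<and> m * (p + 1) - 1 \<le> s \<and>
        [r = s] (mod (p * (p - 1))) \<longrightarrow>
          quot (Vdiv r n :: 'p bipoly set) (Vdiv r m) \<cong>\<^sub>\<Gamma> quot (Vdiv s n :: 'p bipoly set) (Vdiv s m) \<and>
          quot (Xdiv r i n :: 'p bipoly set) (Xdiv r i m) \<cong>\<^sub>\<Gamma>
            quot (Xdiv s i n :: 'p bipoly set) (Xdiv s i m)) \<and>
     (\<forall>i r s. i \<le> p - 1 \<and> s \<le> r \<and> i * (p + 1) + p \<le> s \<and> [r = s] (mod (p * (p - 1))) \<longrightarrow>
          (Qmod r i :: ('p, 'p bipoly set) gmodule) \<cong>\<^sub>\<Gamma> (Qmod s i :: ('p, 'p bipoly set) gmodule))"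
proof (intro conjI allI impI; elim conjE)
  fix n m i r s
  assume *: "n < m" "m \<le> p" "i \<le> p - 1" "s \<le> r" "m * (p + 1) - 1 \<le> s" "[r = s] (mod (p * (p - 1)))"
  obtain k where k: "r = s + k" "p * (p - 1) dvd k" using cong_obtain_add[OF *(6,4)] .
  show "quot (Vdiv r n :: 'p bipoly set) (Vdiv r m) \<cong>\<^sub>\<Gamma> quot (Vdiv s n :: 'p bipoly set) (Vdiv s m)"
    unfolding k(1) by (rule Vdiv_quot_isomorphic) (use * k p in auto)
  show "quot (Xdiv r i n :: 'p bipoly set) (Xdiv r i m) \<cong>\<^sub>\<Gamma>
      quot (Xdiv s i n :: 'p bipoly set) (Xdiv s i m)"
    unfolding k(1) by (rule Xdiv_quot_isomorphic) (use * k p in auto)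
next
  fix i r s
  assume *: "i \<le> p - 1" "s \<le> r" "i * (p + 1) + p \<le> s" "[r = s] (mod (p * (p - 1)))"
  obtain k where k: "r = s + k" "p * (p - 1) dvd k" using cong_obtain_add[OF *(4,2)] .
  have "i + 1 \<le> p" using *(1) p prime_gt_0_nat[OF prime_card[where 'a = 'p]] by linarith
  then have "i + 1 \<le> CARD('p)" by (simp add: p)
  show "(Qmod r i :: ('p, 'p bipoly set) gmodule) \<cong>\<^sub>\<Gamma> (Qmod s i :: ('p, 'p bipoly set) gmodule)"
    unfolding k(1) Qmod_def by (intro Xsub_plus_Vdiv_quot_isomorphic) (use * k p \<open>i + 1 \<le> CARD('p)\<close> in auto)
qed

end
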